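(* Fix one of the two deadline types (DBS or DES), and let $n\ge 1$ basic nodes with parameters $m_k\in\{1,2,\ldots\}$, $\mu_k>0$ ($k=1,\ldots,n$), $\theta>0$, a total arrival rate $\lambda>0$ and a cost $C>0$ be given, with the basic nodes ordered so that $\alpha_1\le\cdots\le\alpha_n$. Assume that the following (conjectured) property holds: for every M/M/$m+$M queue, under either DBS or DES, the mean abandonment rate $\ell(\lambda)$ is (strictly) increasing and strictly convex in the arrival rate $\lambda$, and has a smooth derivative satisfying $\ell'(\lambda)\nearrow 1$ as $\lambda\nearrow\infty$. Let $\alpha^*=\min\{C,C^*(\lambda)\}$. Then: (a) $\boldsymbol{\lambda}^*(\alpha^* )=(\lambda_k^*(\alpha^* ))_{k=0}^n$ is the optimal BS, i.e., the (unique) globally optimal solution of $$\text{minimize } \sum_{k=1}^n \ell_k(\lambda_k)+C\lambda_0\quad\text{subject to } \lambda_0,\lambda_1,\ldots,\lambda_n\ge 0,\ \sum_{k=0}^n\lambda_k=\lambda;$$ (b) $\lambda_0^*(\alpha^* )>0$ if and only if $C<C^*(\lambda)$; (c) for each $k=1,\ldots,n$, $\lambda_k^*(\alpha^* )>0$ if and only if $\alpha^*>\alpha_k$.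
   Context: M/M/$m+$M queue: jobs arrive as a Poisson process of rate $\lambda$ to a node with $m$ identical exponential servers of rate $\mu$, an unlimited buffer and FCFS scheduling; each job has an independent exponential relative deadline (time from arrival to deadline expiration) with rate $\theta>0$, and abandons the system immediately upon missing it. Under DBS (deadline to the beginning of service) a job abandons if its deadline expires before its service starts; under DES (deadline to the end of service) a job abandons if its deadline expires before its service ends. The number of jobs in system is a birth-death process with birth rate $\lambda$ and death rate $\min(i,m)\mu+L(i)$ in state $i$, where the total abandonment rate is $L(i)=(i-m)^+\theta$ under DBS and $L(i)=i\theta$ under DES. The steady-state probability that a random arrival abandons is $P_{\mathrm{ab}}(\lambda)$, and the mean abandonment rate is $\ell(\lambda)=\lambda P_{\mathrm{ab}}(\lambda)$ (equal to the steady-state mean of $L$). Model: there are $n$ basic service nodes $k=1,\ldots,n$ and an external node $k=0$ (infinitely many servers) with expected usage cost $C>0$ per job. A Bernoulli splitting (BS) splits the total arrival rate $\lambda$ into rates $\lambda_k$ for nodes $k=0,1,\ldots,n$; basic node $k$ then behaves as an M/M/$m_k+$M queue with arrival rate $\lambda_k$, server rate $\mu_k$, abandonment rate $\theta$, and mean abandonment rate $\ell_k(\lambda_k)$ (all nodes have the same deadline type). Let $\alpha_k=\ell_k'(0^+)$, which is the probability that an arrival to an empty node $k$ abandons: $\alpha_k=0$ under DBS and $\alpha_k=\theta/(\theta+\mu_k)$ under DES. Under the assumed property, for each $k=1,\ldots,n$ and $\alpha\in(\alpha_k,1)$, $\lambda_k^*(\alpha)>0$ denotes the unique root of the equation $\ell_k'(\lambda_k)=\alpha$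 in $\lambda_k$; one extends $\lambda_k^*(\alpha)=0$ for $0\le\alpha\le\alpha_k$ and $\lambda_k^*(\alpha)=\infty$ for $\alpha\ge 1$. Let $\Lambda^*(\alpha)=\sum_{k=1}^n\lambda_k^*(\alpha)$ and $\lambda_0^*(\alpha)=\lambda-\Lambda^*(\alpha)$. For $\lambda>0$, $C^*(\lambda)$ is the unique root $\alpha\in(\alpha_1,1)$ of the equation $\Lambda^*(\alpha)=\lambda$. *)

theory Defs
  imports "HOL-Probability.Probability"
begin

datatype deadline = DBS | DES

fun abandonment_rate :: "deadline \<Rightarrow> nat \<Rightarrow> real \<Rightarrow> nat \<Rightarrow> real" where
  "abandonment_rate DBS m \<theta> i = real (i - m) * \<theta>"  \<comment> \<open>truncated subtraction is the positive part\<close>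
| "abandonment_rate DES m \<theta> i = real i * \<theta>"

definition death_rate :: "deadline \<Rightarrow> nat \<Rightarrow> real \<Rightarrow> real \<Rightarrow> nat \<Rightarrow> real" where
  "death_rate d m \<mu> \<theta> i = real (min i m) * \<mu> + abandonment_rate d m \<theta> i"

text \<open>Global balance equations of the birth-death process on the number of jobs in system:
  for every state, the probability flow out equals the probability flow in.\<close>

definition stationary :: "deadline \<Rightarrow> nat \<Rightarrow> real \<Rightarrow> real \<Rightarrow> real \<Rightarrow> nat pmf \<Rightarrow> bool" where
  "stationary d m \<mu> \<theta> r p \<longleftrightarrow>
     (\<forall>i. pmf p i * (r + death_rate d m \<mu> \<theta> i) =
        (if i = 0 then 0 else pmf p (i - 1) * r) + pmf p (Suc i) * death_rate d m \<mu> \<theta> (Suc i))"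

definition steady_state :: "deadline \<Rightarrow> nat \<Rightarrow> real \<Rightarrow> real \<Rightarrow> real \<Rightarrow> nat pmf" where
  "steady_state d m \<mu> \<theta> r = (THE p. stationary d m \<mu> \<theta> r p)"

definition mean_abandonment_rate :: "deadline \<Rightarrow> nat \<Rightarrow> real \<Rightarrow> real \<Rightarrow> real \<Rightarrow> real" where
  "mean_abandonment_rate d m \<mu> \<theta> r =
     measure_pmf.expectation (steady_state d m \<mu> \<theta> r) (abandonment_rate d m \<theta>)"

lemma death_rate_0 [simp]: "death_rate d m \<mu> \<theta> 0 = 0"
  by (cases d) (auto simp: death_rate_def)

lemma death_rate_pos:
  assumes "m \<ge> 1" "\<mu> > 0" "\<theta> > 0" "i > 0"
  shows "death_rate d m \<mu> \<theta> i > 0"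
  using assms by (cases d) (auto simp: death_rate_def intro!: add_pos_nonneg)

text \<open>The steady state exists and is unique for every nonnegative arrival rate, so the definite
  description above is well defined.\<close>

lemma stationary_iff_detailed:
  "stationary d m \<mu> \<theta> r p \<longleftrightarrow>
     (\<forall>i. pmf p i * r = pmf p (Suc i) * death_rate d m \<mu> \<theta> (Suc i))"
  (is "?L \<longleftrightarrow> ?R")
proof
  assume L: ?L
  show ?R
  proof
    fix i show "pmf p i * r = pmf p (Suc i) * death_rate d m \<mu> \<theta> (Suc i)"
    proof (induction i)
      case 0
      then show ?case using L[unfolded stationary_def, rule_format, of 0] by simp
    next
      case (Suc i)
      then show ?case using L[unfolded stationary_def, rule_format, of "Suc i"]
        by (simp add: algebra_simps)
    qed
  qed
next
  assume R: ?R
  show ?L unfolding stationary_def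
  proof
    fix i show "pmf p i * (r + death_rate d m \<mu> \<theta> i) =
        (if i = 0 then 0 else pmf p (i - 1) * r) + pmf p (Suc i) * death_rate d m \<mu> \<theta> (Suc i)"
      using R[rule_format, of i] R[rule_format, of "i - 1"]
      by (cases i) (auto simp: algebra_simps)
  qed
qed

lemma ex1_stationary:
  assumes m: "m \<ge> 1" and mu: "\<mu> > 0" and th: "\<theta> > 0" and r: "r \<ge> 0"
  shows "\<exists>!p. stationary d m \<mu> \<theta> r p"
proof -
  define w where "w i = (\<Prod>j<i. r / death_rate d m \<mu> \<theta> (Suc j))" for i
  note pos = death_rate_pos[OF m mu th]
  have w0: "w 0 = 1" and wS: "w (Suc i) * death_rate d m \<mu> \<theta> (Suc i) = w i * r" for i
    using pos[of "Suc i" d] by (simp_all add: w_def)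
  have wn: "w i \<ge> 0" for i
    unfolding w_def by (intro prod_nonneg ballI divide_nonneg_pos pos r) simp
  obtain N where N: "real N * \<theta> \<ge> 2 * r"
    using th by (metis ex_less_of_nat_mult less_imp_le)
  have sw: "summable w"
  proof (rule summable_ratio_test[where c = "1/2" and N = "N + m"])
    fix i assume i: "i \<ge> N + m"
    have "real N * \<theta> \<le> real (Suc i - m) * \<theta>"
      using i th by (intro mult_right_mono) auto
    also have "\<dots> \<le> death_rate d m \<mu> \<theta> (Suc i)"
      using m mu th by (cases d) (auto simp: death_rate_def intro!: add_nonneg_nonneg mult_right_mono
        add_increasing)
    finally have D: "death_rate d m \<mu> \<theta> (Suc i) \<ge> 2 * r" using N by simp
    have "w (Suc i) = w i * (r / death_rate d m \<mu> \<theta> (Suc i))" by (simp add: w_def)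
    also have "\<dots> \<le> w i * (1/2)"
      using D pos[of "Suc i" d] wn[of i] by (intro mult_left_mono) (auto simp: field_simps)
    finally show "norm (w (Suc i)) \<le> 1/2 * norm (w i)" using wn by simp
  qed simp
  define S where "S = suminf w"
  have Spos: "S > 0"
    using suminf_pos2[OF sw wn, of 0] w0 by (simp add: S_def)
  define p where "p = embed_pmf (\<lambda>i. w i / S)"
  have pmfp: "pmf p i = w i / S" for i
    unfolding p_def
  proof (rule pmf_embed_pmf)
    show "w i / S \<ge> 0" for i using wn Spos by simp
    have "(\<lambda>i. w i / S) sums (S / S)"
      unfolding S_def by (intro sums_divide summable_sums sw)
    hence "(\<lambda>i. ennreal (w i / S)) sums ennreal (S / S)"
      using wn Spos by (subst sums_ennreal) auto
    thus "(\<integral>\<^sup>+ i. ennreal (w i / S) \<partial>count_space UNIV) = 1"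
      using Spos by (simp add: nn_integral_count_space_nat sums_iff)
  qed
  have st: "stationary d m \<mu> \<theta> r p"
    unfolding stationary_iff_detailed pmfp using wS by simp
  have uniq: "q = p" if q: "stationary d m \<mu> \<theta> r q" for q
  proof -
    have qw: "pmf q i = pmf q 0 * w i" for i
    proof (induction i)
      case 0 then show ?case by (simp add: w0)
    next
      case (Suc i)
      have "pmf q (Suc i) * death_rate d m \<mu> \<theta> (Suc i) = pmf q 0 * w i * r"
        using q[unfolded stationary_iff_detailed, rule_format, of i] Suc by simp
      also have "\<dots> = pmf q 0 * w (Suc i) * death_rate d m \<mu> \<theta> (Suc i)"
        using wS[of i] by simp
      finally show ?case using pos[of "Suc i" d] by simp
    qed
    have "(\<lambda>i. pmf q i) sums 1"
    proof -
      have "(\<Sum>i. ennreal (pmf q i)) = 1"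
        using nn_integral_pmf_eq_1[of q] by (simp add: nn_integral_count_space_nat)
      hence "(\<lambda>i. ennreal (pmf q i)) sums ennreal 1"
        by (metis ennreal_1 summableI summable_sums)
      thus ?thesis by (simp only: sums_ennreal[OF pmf_nonneg zero_le_one])
    qed
    hence "(\<lambda>i. pmf q 0 * w i) sums 1"
      by (simp only: qw[symmetric])
    moreover have "(\<lambda>i. pmf q 0 * w i) sums (pmf q 0 * S)"
      unfolding S_def by (intro sums_mult summable_sums sw)
    ultimately have "pmf q 0 * S = 1"
      by (simp add: sums_iff)
    hence q0: "pmf q 0 = 1 / S" using Spos by (simp add: field_simps)
    have "pmf q i = pmf p i" for i
      by (subst qw) (simp add: q0 pmfp)
    thus ?thesis by (rule pmf_eqI)
  qed
  show ?thesis using st uniq by blast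
qed

definition strictly_convex_on :: "real set \<Rightarrow> (real \<Rightarrow> real) \<Rightarrow> bool" where
  "strictly_convex_on S f \<longleftrightarrow> convex S \<and>
     (\<forall>x\<in>S. \<forall>y\<in>S. \<forall>t. x \<noteq> y \<longrightarrow> 0 < t \<longrightarrow> t < 1 \<longrightarrow>
        f ((1 - t) * x + t * y) < (1 - t) * f x + t * f y)"

text \<open>The conjectured property of the mean abandonment rate, for all M/M/m+M queues and both
  deadline types. Smoothness is required at positive arrival rates, where the two-sided
  derivative makes sense.\<close>

definition abandonment_conjecture :: bool where
  "abandonment_conjecture \<longleftrightarrow>
     (\<forall>d m \<mu> \<theta>. m \<ge> 1 \<longrightarrow> \<mu> > 0 \<longrightarrow> \<theta> > 0 \<longrightarrow>
        (let l = mean_abandonment_rate d m \<mu> \<theta> in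
           strict_mono_on {0..} l \<and>
           strictly_convex_on {0..} l \<and>
           (\<forall>j. (deriv ^^ j) l differentiable_on {0<..}) \<and>
           mono_on {0<..} (deriv l) \<and>
           (deriv l \<longlongrightarrow> 1) at_top))"

definition initial_slope :: "(real \<Rightarrow> real) \<Rightarrow> real" where
  "initial_slope l = Lim (at_right 0) (deriv l)"

text \<open>Below, \<open>l k\<close> is the mean abandonment rate of basic node \<open>k\<close> as a function of its arrival
  rate, \<open>r\<close> is the total arrival rate, and node \<open>0\<close> is the external node.\<close>

definition node_rate_star :: "(real \<Rightarrow> real) \<Rightarrow> real \<Rightarrow> ereal" where
  "node_rate_star f \<alpha> =
     (if \<alpha> \<le> initial_slope f then 0
      else if \<alpha> < 1 then ereal (THE x. x > 0 \<and> deriv f x = \<alpha>)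
      else \<infinity>)"

definition total_rate_star :: "(nat \<Rightarrow> real \<Rightarrow> real) \<Rightarrow> nat \<Rightarrow> real \<Rightarrow> ereal" where
  "total_rate_star l n \<alpha> = (\<Sum>k=1..n. node_rate_star (l k) \<alpha>)"

definition rate_star :: "(nat \<Rightarrow> real \<Rightarrow> real) \<Rightarrow> nat \<Rightarrow> real \<Rightarrow> real \<Rightarrow> nat \<Rightarrow> ereal" where
  "rate_star l n r \<alpha> k =
     (if k = 0 then ereal r - total_rate_star l n \<alpha> else node_rate_star (l k) \<alpha>)"

definition cost_star :: "(nat \<Rightarrow> real \<Rightarrow> real) \<Rightarrow> nat \<Rightarrow> real \<Rightarrow> real" where
  "cost_star l n r =
     (THE \<alpha>. initial_slope (l 1) < \<alpha> \<and> \<alpha> < 1 \<and> total_rate_star l n \<alpha> = ereal r)"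

definition is_splitting :: "nat \<Rightarrow> real \<Rightarrow> (nat \<Rightarrow> real) \<Rightarrow> bool" where
  "is_splitting n r x \<longleftrightarrow> (\<forall>k\<le>n. x k \<ge> 0) \<and> (\<Sum>k\<le>n. x k) = r"

definition splitting_cost ::
    "(nat \<Rightarrow> real \<Rightarrow> real) \<Rightarrow> nat \<Rightarrow> real \<Rightarrow> (nat \<Rightarrow> real) \<Rightarrow> real" where
  "splitting_cost l n C x = (\<Sum>k=1..n. l k (x k)) + C * x 0"

text \<open>Only the coordinates \<open>0, \<dots>, n\<close> of a splitting matter, so uniqueness is asserted on these.\<close>

definition unique_optimal_splitting ::
    "(nat \<Rightarrow> real \<Rightarrow> real) \<Rightarrow> nat \<Rightarrow> real \<Rightarrow> real \<Rightarrow> (nat \<Rightarrow> real) \<Rightarrow> bool" where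
  "unique_optimal_splitting l n C r x \<longleftrightarrow>
     is_arg_min (splitting_cost l n C) (is_splitting n r) x \<and>
     (\<forall>y. is_arg_min (splitting_cost l n C) (is_splitting n r) y \<longrightarrow> (\<forall>k\<le>n. y k = x k))"

end

(* The total cost is compared with its linearisation at the Lagrange multiplier \<alpha>: the cost of
  every node lies above its supporting line of slope \<alpha> at the candidate rate, for basic nodes
  strictly away from the point of contact, and these lines add up to the same value for all
  splittings. The multiplier C*(\<lambda>) exists because the total rate is continuous in \<alpha>,
  vanishes at the smallest initial slope, and is at least \<lambda> at \<alpha> = \<ell>_1'(\<lambda>). *)

theory Submission
  imports Defs
begin

section \<open>Convexity of a single node: tangent lines, range of the derivative, slope at
  0\<close>

locale abandonment_curve =
  fixes f :: "real \<Rightarrow> real"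
  assumes strict_mono: "strict_mono_on {0..} f"
    and strictly_convex: "strictly_convex_on {0..} f"
    and has_deriv: "\<And>x. x > 0 \<Longrightarrow> (f has_real_derivative deriv f x) (at x)"
    and continuous_deriv: "continuous_on {0<..} (deriv f)"
    and deriv_tendsto_1: "(deriv f \<longlongrightarrow> 1) at_top"
begin

text \<open>Strict convexity at the single weight 1/2 is enough to upgrade weak tangent inequalities
  to strict ones: apply the weak inequality at the midpoint.\<close>

lemma midpoint_less:
  assumes "x \<ge> 0" "y \<ge> 0" "x \<noteq> y"
  shows "f ((x + y) / 2) < (f x + f y) / 2"
proof -
  have "f ((1 - 1/2) * x + 1/2 * y) < (1 - 1/2) * f x + 1/2 * f y"
    using strictly_convex[unfolded strictly_convex_on_def, THEN conjunct2, rule_format, of x y "1/2"]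
      assms by simp
  moreover have "(1 - 1/2) * x + 1/2 * y = (x + y) / 2"
    by (simp add: field_simps)
  ultimately show ?thesis by (simp add: field_simps)
qed

lemma convex: "convex_on {0..} f"
proof (rule convex_onI)
  fix t x y :: real
  assume *: "0 < t" "t < 1" "x \<in> {0..}" "y \<in> {0..}"
  show "f ((1 - t) *\<^sub>R x + t *\<^sub>R y) \<le> (1 - t) * f x + t * f y"
  proof (cases "x = y")
    case True
    then show ?thesis by (simp add: algebra_simps)
  next
    case False
    then show ?thesis
      using strictly_convex * unfolding strictly_convex_on_def by fastforce
  qed
qed simp

lemma above_tangent:
  assumes "x > 0" "y \<ge> 0"
  shows "f x + deriv f x * (y - x) \<le> f y"
proof -
  have "f y - f x \<ge> deriv f x * (y - x)"
  proof (rule convex_on_imp_above_tangent[OF convex])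
    show "x \<in> interior {0..}" using assms by simp
    show "(f has_real_derivative deriv f x) (at x within {0..})"
      using has_deriv assms by (blast intro: has_field_derivative_at_within)
  qed (use assms in auto)
  then show ?thesis by simp
qed

lemma strictly_above_tangent:
  assumes "x > 0" "y \<ge> 0" "y \<noteq> x"
  shows "f x + deriv f x * (y - x) < f y"
proof -
  have "f x + deriv f x * ((x + y) / 2 - x) \<le> f ((x + y) / 2)"
    using assms by (intro above_tangent) auto
  also have "\<dots> < (f x + f y) / 2"
    using assms by (intro midpoint_less) auto
  finally show ?thesis by (simp add: field_simps)
qed

text \<open>Add the strict tangent inequality at \<open>x\<close> evaluated at \<open>y\<close> to
  the one at \<open>y\<close> evaluated at \<open>x\<close>; the function values cancel.\<close>

lemma deriv_strict_mono:
  assumes "0 < x" "x < y"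
  shows "deriv f x < deriv f y"
proof -
  have "f x + deriv f x * (y - x) < f y" "f y + deriv f y * (x - y) < f x"
    using assms by (auto intro!: strictly_above_tangent)
  then have "deriv f x * (y - x) < deriv f y * (y - x)"
    by (simp add: algebra_simps)
  then show ?thesis using assms by simp
qed

lemma deriv_less_iff: "x > 0 \<Longrightarrow> y > 0 \<Longrightarrow> deriv f x < deriv f y \<longleftrightarrow> x < y"
  by (metis deriv_strict_mono less_irrefl less_trans linorder_neqE)

text \<open>The tangent at \<open>x\<close>, evaluated at 0, is at most \<open>f 0 < f x\<close>, so
  it cannot slope downwards.\<close>

lemma deriv_nonneg:
  assumes "x > 0"
  shows "deriv f x \<ge> 0"
proof -
  have "f x + deriv f x * (0 - x) \<le> f 0" using assms by (intro above_tangent) auto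
  moreover have "f 0 < f x"
    using strict_mono assms by (auto simp: strict_mono_on_def)
  ultimately have "deriv f x * x \<ge> 0" by simp
  then show ?thesis using assms by (simp add: zero_le_mult_iff)
qed

lemma deriv_less_1:
  assumes "x > 0"
  shows "deriv f x < 1"
proof -
  have "eventually (\<lambda>y. deriv f (x + 1) \<le> deriv f y) at_top"
    using eventually_gt_at_top[of "x + 1"]
    by eventually_elim (use assms in \<open>auto intro!: less_imp_le deriv_strict_mono\<close>)
  \<comment> \<open>The limit yields only a weak bound, so it is taken one unit further right and
    strict monotonicity of the derivative recovers strictness at \<open>x\<close>.\<close>
  then have "deriv f (x + 1) \<le> 1"
    by (intro tendsto_lowerbound[OF deriv_tendsto_1]) auto
  moreover have "deriv f x < deriv f (x + 1)"
    using assms by (intro deriv_strict_mono) auto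
  ultimately show ?thesis by simp
qed

text \<open>\<open>initial_slope\<close> is a \<open>Lim\<close>, informative only once convergence
  is known. The derivative is increasing and bounded below by 0, so it converges to its
  infimum.\<close>

lemma deriv_tendsto_initial_slope: "(deriv f \<longlongrightarrow> initial_slope f) (at_right 0)"
proof -
  define a where "a = Inf (deriv f ` {0<..})"
  have bdd: "bdd_below (deriv f ` {0<..})"
    using deriv_nonneg by (intro bdd_belowI[of _ 0]) auto
  have "(deriv f \<longlongrightarrow> a) (at_right 0)"
  proof (rule order_tendstoI)
    fix b assume "b < a"
    then have "b < deriv f x" if "x > 0" for x
      using cINF_lower[OF bdd, of x] that by (simp add: a_def)
    then show "eventually (\<lambda>x. b < deriv f x) (at_right 0)"
      using eventually_at_right_less by (rule eventually_mono[rotated])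
  next
    fix b assume "a < b"
    then obtain x where x: "x > 0" "deriv f x < b"
      using cInf_lessD[of "deriv f ` {0<..}" b] by (auto simp: a_def)
    show "eventually (\<lambda>y. deriv f y < b) (at_right 0)"
      unfolding eventually_at_right_field
      using x deriv_strict_mono by (intro exI[of _ x]) (auto intro: less_trans)
  qed
  then show ?thesis
    unfolding initial_slope_def by (metis tendsto_Lim trivial_limit_at_right_real)
qed

lemma initial_slope_less_deriv:
  assumes "x > 0"
  shows "initial_slope f < deriv f x"
proof -
  have "eventually (\<lambda>y. deriv f y \<le> deriv f (x / 2)) (at_right 0)"
    unfolding eventually_at_right_field
    using assms by (intro exI[of _ "x / 2"]) (auto intro!: less_imp_le deriv_strict_mono)
  then have "initial_slope f \<le> deriv f (x / 2)"
    by (intro tendsto_upperbound[OF deriv_tendsto_initial_slope]) auto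
  also have "\<dots> < deriv f x"
    using assms by (intro deriv_strict_mono) auto
  finally show ?thesis .
qed

lemma initial_slope_less_1: "initial_slope f < 1"
  using initial_slope_less_deriv[of 1] deriv_less_1[of 1] by simp

lemma strictly_above_initial_tangent:
  assumes "y > 0"
  shows "f 0 + initial_slope f * y < f y"
proof -
  have le: "f 0 + initial_slope f * z \<le> f z" if z: "z > 0" for z
  proof (rule tendsto_upperbound)
    show "((\<lambda>x. f 0 + deriv f x * (z - x)) \<longlongrightarrow> f 0 + initial_slope f * z) (at_right 0)"
      using deriv_tendsto_initial_slope by (auto intro!: tendsto_eq_intros)
    show "eventually (\<lambda>x. f 0 + deriv f x * (z - x) \<le> f z) (at_right 0)"
      using eventually_at_right_less
    proof eventually_elim
      case (elim x)
      \<comment> \<open>Monotonicity stands in for continuity at 0: lowering the tangent at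
        \<open>x\<close> from \<open>f x\<close> to \<open>f 0\<close> keeps it below
        \<open>f z\<close>, and now \<open>x\<close> can tend to 0.\<close>
      have "f 0 < f x" using strict_mono elim by (auto simp: strict_mono_on_def)
      then show ?case using above_tangent[of x z] elim z by simp
    qed
  qed simp
  have "f 0 + initial_slope f * (y / 2) \<le> f ((0 + y) / 2)"
    using le[of "y / 2"] assms by simp
  also have "\<dots> < (f 0 + f y) / 2"
    using assms by (intro midpoint_less) auto
  finally show ?thesis by (simp add: field_simps)
qed

section \<open>Inverting the derivative\<close>

lemma ex1_deriv_eq:
  assumes "initial_slope f < \<alpha>" "\<alpha> < 1"
  shows "\<exists>!x. x > 0 \<and> deriv f x = \<alpha>"
proof -
  obtain x where x: "x > 0" "deriv f x < \<alpha>"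
    using eventually_conj[OF eventually_at_right_less
        order_tendstoD(2)[OF deriv_tendsto_initial_slope assms(1)]]
    by (auto dest: eventually_happens)
  obtain y where y: "y > x" "\<alpha> < deriv f y"
    using eventually_conj[OF eventually_gt_at_top[of x]
        order_tendstoD(1)[OF deriv_tendsto_1 assms(2)]]
    by (auto dest: eventually_happens)
  have "continuous_on {x..y} (deriv f)"
    using x by (intro continuous_on_subset[OF continuous_deriv]) auto
  then obtain z where "x \<le> z" "deriv f z = \<alpha>"
    using IVT'[of "deriv f" x \<alpha> y] x y by auto
  then show ?thesis
    using x deriv_less_iff by (metis less_irrefl less_le_trans linorder_neqE)
qed

text \<open>Real-valued counterpart of \<open>node_rate_star\<close>. For \<alpha> \<ge> 1 the
  description has no witness and the value is unspecified, hence the bound \<alpha> < 1 in what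
  follows.\<close>

definition inverse_deriv :: "real \<Rightarrow> real" where
  "inverse_deriv \<alpha> = (if \<alpha> \<le> initial_slope f then 0 else THE x. x > 0 \<and> deriv f x = \<alpha>)"

lemma node_rate_star_eq: "\<alpha> < 1 \<Longrightarrow> node_rate_star f \<alpha> = ereal (inverse_deriv \<alpha>)"
  by (simp add: node_rate_star_def inverse_deriv_def)

lemma inverse_deriv_eq_0: "\<alpha> \<le> initial_slope f \<Longrightarrow> inverse_deriv \<alpha> = 0"
  by (simp add: inverse_deriv_def)

lemma
  assumes "initial_slope f < \<alpha>" "\<alpha> < 1"
  shows inverse_deriv_pos: "inverse_deriv \<alpha> > 0"
    and deriv_inverse_deriv: "deriv f (inverse_deriv \<alpha>) = \<alpha>"
  using theI'[OF ex1_deriv_eq[OF assms]] assms by (auto simp: inverse_deriv_def)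

lemma inverse_deriv_nonneg: "\<alpha> < 1 \<Longrightarrow> inverse_deriv \<alpha> \<ge> 0"
  using inverse_deriv_pos inverse_deriv_eq_0 by (metis less_le not_le order_refl)

lemma inverse_deriv_pos_iff: "\<alpha> < 1 \<Longrightarrow> inverse_deriv \<alpha> > 0 \<longleftrightarrow> initial_slope f < \<alpha>"
  using inverse_deriv_pos inverse_deriv_eq_0 by (metis less_irrefl not_le)

text \<open>With its mirror image below, this trades comparisons of rates for comparisons of slopes,
  uniformly over the zero and positive branches of the inverse. Monotonicity and continuity are read
  off from it.\<close>

lemma inverse_deriv_less_iff:
  assumes "\<alpha> < 1" "x > 0"
  shows "inverse_deriv \<alpha> < x \<longleftrightarrow> \<alpha> < deriv f x"
proof (cases "initial_slope f < \<alpha>")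
  case True
  then show ?thesis
    using deriv_less_iff[of "inverse_deriv \<alpha>" x] inverse_deriv_pos deriv_inverse_deriv assms by simp
next
  case False
  then show ?thesis
    using inverse_deriv_eq_0 initial_slope_less_deriv[of x] assms by simp
qed

lemma less_inverse_deriv_iff:
  assumes "\<alpha> < 1" "x > 0"
  shows "x < inverse_deriv \<alpha> \<longleftrightarrow> deriv f x < \<alpha>"
proof (cases "initial_slope f < \<alpha>")
  case True
  then show ?thesis
    using deriv_less_iff[of x "inverse_deriv \<alpha>"] inverse_deriv_pos deriv_inverse_deriv assms by simp
next
  case False
  then show ?thesis
    using inverse_deriv_eq_0 initial_slope_less_deriv[of x] assms by simp
qed

lemma inverse_deriv_deriv:
  assumes "x > 0"
  shows "inverse_deriv (deriv f x) = x"
  using inverse_deriv_less_iff[of "deriv f x" x] less_inverse_deriv_iff[of "deriv f x" x]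
    deriv_less_1 assms by force

lemma inverse_deriv_strict_mono:
  assumes "initial_slope f < \<beta>" "\<alpha> < \<beta>" "\<beta> < 1"
  shows "inverse_deriv \<alpha> < inverse_deriv \<beta>"
  using assms inverse_deriv_less_iff[of \<alpha> "inverse_deriv \<beta>"] inverse_deriv_pos deriv_inverse_deriv
  by simp

lemma inverse_deriv_mono:
  assumes "\<alpha> \<le> \<beta>" "\<beta> < 1"
  shows "inverse_deriv \<alpha> \<le> inverse_deriv \<beta>"
  using assms inverse_deriv_strict_mono[of \<beta> \<alpha>] inverse_deriv_eq_0
  by (cases "\<alpha> = \<beta>"; cases "initial_slope f < \<beta>") auto

text \<open>A strict bound on the inverse is equivalent to a strict bound on its argument, which
  persists nearby.\<close>

lemma continuous_inverse_deriv: "continuous_on {..<1} inverse_deriv"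
  unfolding continuous_on_def
proof
  fix \<alpha> :: real assume \<alpha>: "\<alpha> \<in> {..<1}"
  have ev1: "eventually (\<lambda>\<beta>. \<beta> < 1) (at \<alpha> within {..<1})"
    by (auto simp: eventually_at_filter)
  show "(inverse_deriv \<longlongrightarrow> inverse_deriv \<alpha>) (at \<alpha> within {..<1})"
  proof (rule order_tendstoI)
    fix x assume x: "x < inverse_deriv \<alpha>"
    consider "x < 0" | "x = 0" | "x > 0" by linarith
    then show "eventually (\<lambda>\<beta>. x < inverse_deriv \<beta>) (at \<alpha> within {..<1})"
    proof cases
      case 1
      show ?thesis using ev1
        by eventually_elim (use 1 inverse_deriv_nonneg in force)
    next
      \<comment> \<open>The slope comparison requires a positive rate; at rate 0 the threshold is
        the initial slope instead.\<close>
      case 2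
      then have "initial_slope f < \<alpha>" using x \<alpha> inverse_deriv_pos_iff by auto
      from order_tendstoD(1)[OF tendsto_ident_at this] ev1 show ?thesis
        by eventually_elim (use 2 inverse_deriv_pos in auto)
    next
      case 3
      then have "deriv f x < \<alpha>" using x \<alpha> less_inverse_deriv_iff by auto
      from order_tendstoD(1)[OF tendsto_ident_at this] ev1 show ?thesis
        by eventually_elim (use 3 less_inverse_deriv_iff in auto)
    qed
  next
    fix x assume x: "inverse_deriv \<alpha> < x"
    then have pos: "x > 0" using inverse_deriv_nonneg[of \<alpha>] \<alpha> by auto
    then have "\<alpha> < deriv f x" using x \<alpha> inverse_deriv_less_iff by auto
    from order_tendstoD(2)[OF tendsto_ident_at this] ev1
    show "eventually (\<lambda>\<beta>. inverse_deriv \<beta> < x) (at \<alpha> within {..<1})"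
      by eventually_elim (use pos inverse_deriv_less_iff in auto)
  qed
qed

text \<open>Above the initial slope the line is the tangent at the inverse. Otherwise contact is at
  the boundary point 0, where every slope up to the initial one supports the curve.\<close>

lemma strictly_above_supporting_line:
  assumes "\<alpha> < 1" "y \<ge> 0" "y \<noteq> inverse_deriv \<alpha>"
  shows "f (inverse_deriv \<alpha>) + \<alpha> * (y - inverse_deriv \<alpha>) < f y"
proof (cases "initial_slope f < \<alpha>")
  case True
  then show ?thesis
    using strictly_above_tangent[of "inverse_deriv \<alpha>" y] inverse_deriv_pos deriv_inverse_deriv assms
    by simp
next
  case False
  then have *: "inverse_deriv \<alpha> = 0" "y > 0" using inverse_deriv_eq_0 assms by auto
  have "f 0 + \<alpha> * y \<le> f 0 + initial_slope f * y"
    using False * by (simp add: mult_right_mono)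
  also have "\<dots> < f y" using * by (intro strictly_above_initial_tangent)
  finally show ?thesis using * by simp
qed

end

text \<open>Order 0 of the smoothness condition gives the derivative, order 1 its
  continuity.\<close>

lemma abandonment_curve_mean_abandonment_rate:
  assumes "abandonment_conjecture" "m \<ge> 1" "\<mu> > 0" "\<theta> > 0"
  shows "abandonment_curve (mean_abandonment_rate d m \<mu> \<theta>)"
proof -
  define f where "f = mean_abandonment_rate d m \<mu> \<theta>"
  have conj: "strict_mono_on {0..} f" "strictly_convex_on {0..} f"
      "\<And>j. (deriv ^^ j) f differentiable_on {0<..}" "(deriv f \<longlongrightarrow> 1) at_top"
    using assms unfolding abandonment_conjecture_def Let_def f_def by blast+
  have "f differentiable_on {0<..}" using conj(3)[of 0] by simp
  then have "(f has_real_derivative deriv f x) (at x)" if "x > 0" for x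
    using that
    by (simp add: DERIV_deriv_iff_real_differentiable differentiable_on_eq_differentiable_at)
  moreover have "continuous_on {0<..} (deriv f)"
    using conj(3)[of 1] by (simp add: differentiable_imp_continuous_on)
  ultimately show ?thesis
    using conj unfolding f_def[symmetric] by unfold_locales auto
qed

lemma sum_atMost_eq_head_plus: "(\<Sum>k\<le>n. g k) = g 0 + (\<Sum>k=1..n. g k)" for g :: "nat \<Rightarrow> 'a::comm_monoid_add"
  by (simp add: sum.atMost_shift sum.shift_bounds_cl_Suc_ivl atMost_atLeast0 sum.atLeast_Suc_atMost)

section \<open>The total rate of the basic nodes and the multiplier that exhausts the load\<close>

locale abandonment_network =
  fixes l :: "nat \<Rightarrow> real \<Rightarrow> real" and n :: nat and r :: real
  assumes curve: "\<And>k. k \<in> {1..n} \<Longrightarrow> abandonment_curve (l k)"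
    and n_pos: "n \<ge> 1" and r_pos: "r > 0"
    and initial_slope_mono: "mono_on {1..n} (\<lambda>k. initial_slope (l k))"
begin

abbreviation node_rate :: "nat \<Rightarrow> real \<Rightarrow> real" where
  "node_rate k \<equiv> abandonment_curve.inverse_deriv (l k)"

definition total_rate :: "real \<Rightarrow> real" where
  "total_rate \<alpha> = (\<Sum>k=1..n. node_rate k \<alpha>)"

lemma first_node: "1 \<in> {1..n}"
  using n_pos by simp

lemma initial_slope_first_le: "k \<in> {1..n} \<Longrightarrow> initial_slope (l 1) \<le> initial_slope (l k)"
  using initial_slope_mono first_node by (auto simp: mono_on_def)

lemma node_rate_nonneg: "k \<in> {1..n} \<Longrightarrow> \<alpha> < 1 \<Longrightarrow> node_rate k \<alpha> \<ge> 0"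
  using abandonment_curve.inverse_deriv_nonneg curve by blast

lemma total_rate_star_eq:
  assumes "\<alpha> < 1"
  shows "total_rate_star l n \<alpha> = ereal (total_rate \<alpha>)"
proof -
  have "total_rate_star l n \<alpha> = (\<Sum>k=1..n. ereal (node_rate k \<alpha>))"
    unfolding total_rate_star_def
    using assms by (intro sum.cong refl abandonment_curve.node_rate_star_eq curve)
  then show ?thesis by (simp add: total_rate_def)
qed

lemma total_rate_eq_0:
  assumes "\<alpha> \<le> initial_slope (l 1)"
  shows "total_rate \<alpha> = 0"
  unfolding total_rate_def
  using assms initial_slope_first_le
  by (intro sum.neutral ballI abandonment_curve.inverse_deriv_eq_0 curve) (auto intro: order_trans)

lemma total_rate_strict_mono:
  assumes "initial_slope (l 1) < \<beta>" "\<alpha> < \<beta>" "\<beta> < 1"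
  shows "total_rate \<alpha> < total_rate \<beta>"
  unfolding total_rate_def
proof (rule sum_strict_mono_ex1)
  show "\<forall>k\<in>{1..n}. node_rate k \<alpha> \<le> node_rate k \<beta>"
    using assms by (auto intro!: abandonment_curve.inverse_deriv_mono curve)
  \<comment> \<open>Strictness is supplied by node 1, which has the smallest initial slope; other
    nodes may still be idle at both multipliers.\<close>
  show "\<exists>k\<in>{1..n}. node_rate k \<alpha> < node_rate k \<beta>"
    using assms first_node by (blast intro: abandonment_curve.inverse_deriv_strict_mono curve)
qed simp

lemma ex1_total_rate_eq: "\<exists>!\<alpha>. initial_slope (l 1) < \<alpha> \<and> \<alpha> < 1 \<and> total_rate \<alpha> = r"
proof -
  interpret first: abandonment_curve "l 1" using curve first_node .
  \<comment> \<open>At slope \<open>b\<close> node 1 alone already takes the whole load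
    \<open>r\<close>.\<close>
  define b where "b = deriv (l 1) r"
  have b: "initial_slope (l 1) < b" "b < 1"
    using first.initial_slope_less_deriv first.deriv_less_1 r_pos by (auto simp: b_def)
  have "r = node_rate 1 b"
    using first.inverse_deriv_deriv r_pos by (simp add: b_def)
  also have "\<dots> \<le> total_rate b"
    unfolding total_rate_def using first_node b node_rate_nonneg
    by (intro member_le_sum) auto
  finally have r_le: "r \<le> total_rate b" .
  have "continuous_on {initial_slope (l 1)..b} total_rate"
    unfolding total_rate_def using b
    by (intro continuous_on_sum continuous_on_subset[OF abandonment_curve.continuous_inverse_deriv]
        curve) auto
  then obtain \<alpha> where \<alpha>: "initial_slope (l 1) \<le> \<alpha>" "\<alpha> \<le> b" "total_rate \<alpha> = r"
    using IVT'[of total_rate "initial_slope (l 1)" r b] r_le r_pos b total_rate_eq_0 by auto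
  then have "initial_slope (l 1) < \<alpha>"
    using total_rate_eq_0[of \<alpha>] r_pos by linarith
  then show ?thesis
    using \<alpha> b total_rate_strict_mono by (metis le_less_trans less_irrefl linorder_neqE)
qed

lemma
  shows cost_star_gt: "initial_slope (l 1) < cost_star l n r"
    and cost_star_less_1: "cost_star l n r < 1"
    and total_rate_cost_star: "total_rate (cost_star l n r) = r"
proof -
  have "cost_star l n r = (THE \<alpha>. initial_slope (l 1) < \<alpha> \<and> \<alpha> < 1 \<and> total_rate \<alpha> = r)"
    unfolding cost_star_def by (rule arg_cong[where f = The]) (auto simp: total_rate_star_eq)
  then show "initial_slope (l 1) < cost_star l n r" "cost_star l n r < 1"
      "total_rate (cost_star l n r) = r"
    using theI'[OF ex1_total_rate_eq] by auto
qed

text \<open>The bound on \<alpha> keeps it below 1, where \<open>total_rate\<close> is meaningful;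
  equality occurs at \<open>cost_star\<close> and strict monotonicity covers the rest.\<close>

lemma total_rate_less_iff: "\<alpha> \<le> cost_star l n r \<Longrightarrow> total_rate \<alpha> < r \<longleftrightarrow> \<alpha> < cost_star l n r"
  using total_rate_strict_mono[of "cost_star l n r" \<alpha>] cost_star_gt cost_star_less_1
    total_rate_cost_star by (cases "\<alpha> = cost_star l n r") auto

section \<open>Optimality of the candidate splitting\<close>

definition splitting :: "real \<Rightarrow> nat \<Rightarrow> real" where
  "splitting \<alpha> k = (if k = 0 then r - total_rate \<alpha> else node_rate k \<alpha>)"

lemma rate_star_eq:
  assumes "\<alpha> < 1" "k \<le> n"
  shows "rate_star l n r \<alpha> k = ereal (splitting \<alpha> k)"
  using assms abandonment_curve.node_rate_star_eq[OF curve, of k \<alpha>]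
  by (auto simp: rate_star_def splitting_def total_rate_star_eq)

lemma is_splitting_splitting:
  assumes "\<alpha> \<le> cost_star l n r"
  shows "is_splitting n r (splitting \<alpha>)"
proof -
  have "total_rate \<alpha> \<le> r"
    using total_rate_less_iff[OF assms] total_rate_cost_star assms by force
  moreover have "(\<Sum>k=1..n. splitting \<alpha> k) = total_rate \<alpha>"
    unfolding total_rate_def by (intro sum.cong) (auto simp: splitting_def)
  ultimately show ?thesis
    using assms cost_star_less_1 node_rate_nonneg
    by (auto simp: is_splitting_def sum_atMost_eq_head_plus splitting_def)
qed

lemma splitting_cost_less:
  assumes \<alpha>: "\<alpha> = min C (cost_star l n r)"
    and y: "is_splitting n r y" and ne: "\<exists>k\<le>n. y k \<noteq> splitting \<alpha> k"
  shows "splitting_cost l n C (splitting \<alpha>) < splitting_cost l n C y"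
proof -
  define x where "x = splitting \<alpha>"
  have \<alpha>1: "\<alpha> < 1" using cost_star_less_1 \<alpha> by simp
  have x: "is_splitting n r x"
    unfolding x_def using \<alpha> by (intro is_splitting_splitting) simp
  have x_sum: "x 0 + (\<Sum>k=1..n. x k) = r" and y_sum: "y 0 + (\<Sum>k=1..n. y k) = r"
    using x y by (simp_all add: is_splitting_def sum_atMost_eq_head_plus)
  have node: "l k (x k) + \<alpha> * (y k - x k) < l k (y k)" if "k \<in> {1..n}" "y k \<noteq> x k" for k
    using abandonment_curve.strictly_above_supporting_line[OF curve[OF that(1)] \<alpha>1, of "y k"] that y
    by (auto simp: x_def splitting_def is_splitting_def)
  have node_le: "l k (x k) + \<alpha> * (y k - x k) \<le> l k (y k)" if "k \<in> {1..n}" for k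
    using node[OF that] by (cases "y k = x k") auto
  \<comment> \<open>The cost of node 0 is linear and gives no strictness, so a differing basic node
    is required. Conservation of the load rules out a difference at node 0 alone.\<close>
  have "\<exists>k\<in>{1..n}. y k \<noteq> x k"
  proof (rule ccontr)
    assume "\<not> ?thesis"
    then have eq: "y k = x k" if "k \<in> {1..n}" for k using that by blast
    then have "(\<Sum>k=1..n. y k) = (\<Sum>k=1..n. x k)" by (intro sum.cong) auto
    then have "y 0 = x 0" using x_sum y_sum by simp
    then show False using ne eq
      by (metis atLeastAtMost_iff less_one linorder_not_le x_def)
  qed
  then have "(\<Sum>k=1..n. l k (x k) + \<alpha> * (y k - x k)) < (\<Sum>k=1..n. l k (y k))"
    using node node_le by (intro sum_strict_mono_ex1) blast+
  moreover have "(\<Sum>k=1..n. l k (x k) + \<alpha> * (y k - x k)) =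
      (\<Sum>k=1..n. l k (x k)) + \<alpha> * ((\<Sum>k=1..n. y k) - (\<Sum>k=1..n. x k))"
    by (simp add: sum.distrib sum_subtractf flip: sum_distrib_left)
  moreover have "\<alpha> * ((\<Sum>k=1..n. y k) - (\<Sum>k=1..n. x k)) = \<alpha> * (x 0 - y 0)"
    using x_sum y_sum by (intro arg_cong[where f = "(*) \<alpha>"]) simp
  \<comment> \<open>Complementary slackness: either \<alpha> = \<open>C\<close>, or \<alpha> <
    \<open>C\<close> and the candidate leaves node 0 empty, so that \<open>y 0 - x 0\<close> is
    nonnegative.\<close>
  moreover have "C * (y 0 - x 0) \<ge> \<alpha> * (y 0 - x 0)"
  proof (cases "C \<le> cost_star l n r")
    case False
    then have "x 0 = 0" using \<alpha> total_rate_cost_star by (simp add: x_def splitting_def)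
    moreover have "y 0 \<ge> 0" using y by (simp add: is_splitting_def)
    ultimately show ?thesis using \<alpha> by (simp add: mult_right_mono)
  qed (use \<alpha> in simp)
  ultimately show ?thesis
    by (simp add: splitting_cost_def algebra_simps flip: x_def)
qed

text \<open>Every feasible splitting that differs on a relevant coordinate costs strictly more,
  which gives minimality and uniqueness together.\<close>

lemma unique_optimal_splitting_splitting:
  "unique_optimal_splitting l n C r (splitting (min C (cost_star l n r)))"
proof -
  let ?x = "splitting (min C (cost_star l n r))"
  have x: "is_splitting n r ?x" by (intro is_splitting_splitting) simp
  have "\<not> splitting_cost l n C y < splitting_cost l n C ?x" if "is_splitting n r y" for y
  proof (cases "\<exists>k\<le>n. y k \<noteq> ?x k")
    case True
    then show ?thesis using splitting_cost_less[OF refl that] by (meson less_asym)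
  next
    case False
    then have "splitting_cost l n C y = splitting_cost l n C ?x"
      by (auto simp: splitting_cost_def intro!: sum.cong)
    then show ?thesis by simp
  qed
  then show ?thesis
    using x splitting_cost_less[OF refl] unfolding unique_optimal_splitting_def is_arg_min_def
    by blast
qed

end

theorem proposition1:
  fixes d :: deadline and n :: nat and m :: "nat \<Rightarrow> nat" and \<mu> :: "nat \<Rightarrow> real"
    and \<theta> r C :: real
  defines "l \<equiv> \<lambda>k. mean_abandonment_rate d (m k) (\<mu> k) \<theta>"
  defines "\<alpha>opt \<equiv> min C (cost_star l n r)"
  assumes "n \<ge> 1"
    and "\<And>k. k \<in> {1..n} \<Longrightarrow> m k \<ge> 1"
    and "\<And>k. k \<in> {1..n} \<Longrightarrow> \<mu> k > 0"
    and "\<theta> > 0" and "r > 0" and "C > 0"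
    and "mono_on {1..n} (\<lambda>k. initial_slope (l k))"
    and "abandonment_conjecture"
  shows "(\<exists>x. (\<forall>k\<le>n. ereal (x k) = rate_star l n r \<alpha>opt k) \<and> unique_optimal_splitting l n C r x)
    \<and> (rate_star l n r \<alpha>opt 0 > 0 \<longleftrightarrow> C < cost_star l n r)
    \<and> (\<forall>k\<in>{1..n}. rate_star l n r \<alpha>opt k > 0 \<longleftrightarrow> \<alpha>opt > initial_slope (l k))"
proof -
  interpret abandonment_network l n r
  proof (rule abandonment_network.intro)
    fix k assume "k \<in> {1..n}"
    then show "abandonment_curve (l k)"
      unfolding l_def using assms by (intro abandonment_curve_mean_abandonment_rate) auto
  qed (use assms in auto)
  have le: "\<alpha>opt \<le> cost_star l n r" by (simp add: \<alpha>opt_def)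
  \<comment> \<open>This excludes the infinite branch of \<open>node_rate_star\<close>, so all
    extended-real rates reduce to the real \<open>splitting\<close>.\<close>
  then have less_1: "\<alpha>opt < 1" using cost_star_less_1 by simp
  have "\<forall>k\<le>n. ereal (splitting \<alpha>opt k) = rate_star l n r \<alpha>opt k"
    using rate_star_eq[OF less_1] by simp
  moreover have "unique_optimal_splitting l n C r (splitting \<alpha>opt)"
    unfolding \<alpha>opt_def by (rule unique_optimal_splitting_splitting)
  moreover have "rate_star l n r \<alpha>opt 0 > 0 \<longleftrightarrow> C < cost_star l n r"
  proof -
    have "rate_star l n r \<alpha>opt 0 > 0 \<longleftrightarrow> total_rate \<alpha>opt < r"
      by (simp add: rate_star_eq[OF less_1] splitting_def)
    also have "\<dots> \<longleftrightarrow> \<alpha>opt < cost_star l n r" by (rule total_rate_less_iff[OF le])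
    also have "\<dots> \<longleftrightarrow> C < cost_star l n r" by (simp add: \<alpha>opt_def min_less_iff_disj)
    finally show ?thesis .
  qed
  moreover have "rate_star l n r \<alpha>opt k > 0 \<longleftrightarrow> \<alpha>opt > initial_slope (l k)" if "k \<in> {1..n}" for k
    using abandonment_curve.inverse_deriv_pos_iff[OF curve[OF that] less_1] that
    by (simp add: rate_star_eq[OF less_1] splitting_def)
  ultimately show ?thesis by blast
qed

end
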